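(* If $f\in\mathcal{R}$, then (i) $|T^{s}_{2,2}(f^{-1})|\le \frac{25}{9}$; (ii) $|T^{s}_{2,3}(f^{-1})|\le \frac{233}{36}$; (iii) $|T^{s}_{3,2}(f^{-1})|\le \frac{817}{108}$. All estimates are sharp: equality holds in each of (i), (ii), (iii) for the function $f$ defined by $$f'(z)=\frac{1+iz}{1-iz}=1+2iz-2z^2-2iz^3+2z^4+\cdots,\qquad f(0)=0,$$ i.e. for $f(z)=z+iz^2-\frac{2}{3}z^3-\frac{1}{2}iz^4+\cdots$, whose inverse function is $$f^{-1}(w)=w-iw^2-\frac{4}{3}w^3+\frac{13}{6}iw^4+\cdots.$$
   Context: Let $\mathbb{D}=\{z\in\mathbb{C}:|z|<1\}$. $\mathcal{A}$ is the class of functions $f$ analytic in $\mathbb{D}$ with $f(0)=0$, $f'(0)=1$, i.e. $f(z)=z+a_2z^2+a_3z^3+\cdots$. $\mathcal{R}=\{f\in\mathcal{A}:\mathrm{Re}\,f'(z)>0,\ z\in\mathbb{D}\}$ is the class of functions with bounded turning; such functions are univalent (injective) in $\mathbb{D}$. For univalent $f\in\mathcal{A}$ the inverse $f^{-1}$ is defined at least on the disk $|w|<1/4$ (Koebe's 1/4 theorem) and has there an expansion $f^{-1}(w)=w+A_2w^2+A_3w^3+\cdots$. The symmetric Toeplitz determinant $T^{s}_{q,n}(f^{-1})$ is the determinant of the $q\times q$ matrix whose $(i,j)$ entry is $A_{n+|i-j|}$ (no complex conjugation). In particular $$T^{s}_{2,2}(f^{-1})=A_2^2-A_3^2,\quad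 T^{s}_{2,3}(f^{-1})=A_3^2-A_4^2,\quad T^{s}_{3,2}(f^{-1})=(A_2-A_4)(A_2^2-2A_3^2+A_2A_4).$$ *)

theory Defs
  imports
    "HOL-Complex_Analysis.Complex_Analysis"
    "Jordan_Normal_Form.Determinant"
begin

text \<open>
  Functions on the unit disk are total functions on the complex numbers; only their values on
  \<^term>\<open>ball (0::complex) 1\<close> matter below.
\<close>

definition class_A :: "(complex \<Rightarrow> complex) set" where
  "class_A = {f. f holomorphic_on ball 0 1 \<and> f 0 = 0 \<and> deriv f 0 = 1}"

definition class_R :: "(complex \<Rightarrow> complex) set" where
  "class_R = {f \<in> class_A. \<forall>z\<in>ball 0 1. Re (deriv f z) > 0}"

text \<open>
  \<^term>\<open>the_inv_into (ball 0 1) f\<close> is the inverse function when \<open>f\<close> is injective on the disk, as all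
  members of \<^const>\<open>class_R\<close> are; outside the image of the disk its values are unspecified. The
  coefficients depend only on its germ at 0, which is an interior point of that image.
\<close>

definition inv_coeff :: "(complex \<Rightarrow> complex) \<Rightarrow> nat \<Rightarrow> complex" where
  "inv_coeff f n = fps_nth (fps_expansion (the_inv_into (ball 0 1) f) 0) n"

text \<open>
  Matrix indices start at 0, which does not affect \<open>\<bar>i - j\<bar>\<close>. The distance is taken in the integers
  because subtraction of natural numbers truncates. The determinant is that of
  \<^theory>\<open>Jordan_Normal_Form.Determinant\<close>, for matrices whose dimension is a number.
\<close>

definition sym_toeplitz_det :: "nat \<Rightarrow> nat \<Rightarrow> (nat \<Rightarrow> complex) \<Rightarrow> complex" where
  "sym_toeplitz_det q n a =
     Determinant.det (Matrix.mat q q (\<lambda>(i, j). a (n + nat \<bar>int i - int j\<bar>)))"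

abbreviation T_inv :: "nat \<Rightarrow> nat \<Rightarrow> (complex \<Rightarrow> complex) \<Rightarrow> complex" where
  "T_inv q n f \<equiv> sym_toeplitz_det q n (inv_coeff f)"

lemma sym_toeplitz_det_2: "sym_toeplitz_det 2 n a = (a n)\<^sup>2 - (a (n + 1))\<^sup>2"
  unfolding sym_toeplitz_det_def
  by (subst laplace_expansion_row[of _ 2 0])
    (auto simp: numeral_2_eq_2 cofactor_def mat_delete_def det_single power2_eq_square)

lemma sym_toeplitz_det_3:
  "sym_toeplitz_det 3 n a =
     (a n - a (n + 2)) * ((a n)\<^sup>2 - 2 * (a (n + 1))\<^sup>2 + a n * a (n + 2))"
proof -
  have det2: "Determinant.det A = A $$ (0, 0) * A $$ (1, 1) - A $$ (0, 1) * A $$ (1, 0)"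
    if "A \<in> carrier_mat 2 2" for A :: "complex Matrix.mat"
    using that
    by (subst laplace_expansion_row[of _ 2 0])
      (auto simp: numeral_2_eq_2 cofactor_def mat_delete_def det_single)
  show ?thesis
    unfolding sym_toeplitz_det_def
    by (subst laplace_expansion_row[of _ 3 0])
      (auto simp: eval_nat_numeral lessThan_Suc cofactor_def
        det2[unfolded numeral_2_eq_2] mat_delete_def algebra_simps)
qed

end

theory Submission
  imports Defs
begin

text \<open>
  Write \<open>f' = p\<close>. The Cayley transform \<open>(p - 1) / (p + 1)\<close> maps the disk into itself and fixes 0, so by
  Schwarz it equals \<open>z h(z)\<close> with \<open>\<bar>h\<bar> \<le> 1\<close>. Let \<open>h = c\<^sub>1 + c\<^sub>2 z + c\<^sub>3 z\<^sup>2 + \<dots>\<close>. Expressing the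
  coefficients of \<open>p\<close>, then of \<open>f\<close>, then of the inverse of \<open>f\<close> through the \<open>c\<^sub>i\<close> gives
  \<open>A\<^sub>2 = - c\<^sub>1\<close>, \<open>A\<^sub>3 = (4 c\<^sub>1\<^sup>2 - 2 c\<^sub>2) / 3\<close> and \<open>A\<^sub>4 = - c\<^sub>3 / 2 + 7/3 c\<^sub>1 c\<^sub>2 - 13/6 c\<^sub>1\<^sup>3\<close>.

  The main analytic input is that every later coefficient of a function bounded by 1 has modulus at most
  \<open>1 - \<bar>c\<^sub>1\<bar>\<^sup>2\<close> (\<open>norm_coeff_le_one_minus_square\<close>). With it the triangle inequality suffices
  (\<open>inverse_Toeplitz_bounds\<close>): each of \<open>A\<^sub>2\<close>, \<open>A\<^sub>3\<close>, \<open>A\<^sub>4\<close> and the factor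
  \<open>A\<^sub>2\<^sup>2 - 2 A\<^sub>3\<^sup>2 + A\<^sub>2 A\<^sub>4\<close> is bounded by a polynomial in \<open>\<bar>c\<^sub>1\<bar>\<close> which on \<open>[0, 1]\<close> is largest at 1, and
  the three determinants are differences of squares or products of these quantities.

  At \<open>\<bar>c\<^sub>1\<bar> = 1\<close> the other \<open>c\<^sub>i\<close> vanish. Choosing \<open>c\<^sub>1 = \<i>\<close> gives
  \<open>A\<^sub>2 = - \<i>\<close>, \<open>A\<^sub>3 = - 4/3\<close>, \<open>A\<^sub>4 = 13/6 \<i>\<close>: the squares of neighbouring coefficients have opposite
  signs, \<open>A\<^sub>2\<close> and \<open>A\<^sub>4\<close> point in opposite directions, and the remaining factor is
  \<open>c\<^sub>1\<^sup>2 - 25/18 c\<^sub>1\<^sup>4\<close>, with both terms negative. So all the triangle inequalities become equalities.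
  This is the function with \<open>f' = (1 + \<i>z) / (1 - \<i>z)\<close>.
\<close>

section \<open>Coefficients of functions bounded by one\<close>

text \<open>
  Cauchy's estimate on the circle of radius \<open>r\<close> loses a factor \<open>r ^ n\<close>, which disappears as \<open>r\<close> tends to 1.
\<close>

lemma norm_fps_nth_le_of_bounded_on_disk:
  fixes f :: "complex \<Rightarrow> complex"
  assumes hol: "f holomorphic_on ball 0 1" and F: "f has_fps_expansion F"
    and bnd: "\<And>z. z \<in> ball 0 1 \<Longrightarrow> norm (f z) \<le> B"
  shows "norm (fps_nth F n) \<le> B"
proof -
  have "norm (fps_nth F n) * r ^ n \<le> B" if r: "0 < r" "r < 1" for r :: real
  proof -
    have "norm ((deriv ^^ n) f 0) \<le> fact n * B / r ^ n"
    proof (rule Cauchy_inequality)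
      show "f holomorphic_on ball 0 r"
        using hol by (rule holomorphic_on_subset) (use r in auto)
      show "continuous_on (cball 0 r) f"
        using holomorphic_on_imp_continuous_on[OF hol]
        by (rule continuous_on_subset) (use r in auto)
    qed (use r bnd in auto)
    then show ?thesis
      using r by (simp add: fps_nth_fps_expansion[OF F] norm_divide field_simps)
  qed
  then have "\<forall>\<^sub>F r in at_left (1::real). norm (fps_nth F n) * r ^ n \<le> B"
    using eventually_at_left_real[of 0 "1::real"] by (auto elim!: eventually_mono)
  moreover have "((\<lambda>r::real. norm (fps_nth F n) * r ^ n) \<longlongrightarrow> norm (fps_nth F n) * 1 ^ n) (at_left 1)"
    by (intro tendsto_intros)
  ultimately show ?thesis
    using tendsto_upperbound[of _ "norm (fps_nth F n) * 1 ^ n"] by fastforce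
qed

text \<open>
  The Moebius map that sends \<open>c = f 0\<close> to 0 has derivative \<open>1 / (1 - \<bar>c\<bar>\<^sup>2)\<close> at \<open>c\<close>. If \<open>f\<close> agrees with \<open>c\<close> up to
  order \<open>n\<close>, composing with it therefore only divides the \<open>n\<close>-th coefficient by \<open>1 - \<bar>c\<bar>\<^sup>2\<close>, and the
  composition is again bounded by 1.
\<close>

lemma norm_gap_coeff_le_strict:
  fixes f :: "complex \<Rightarrow> complex"
  assumes hol: "f holomorphic_on ball 0 1" and F: "f has_fps_expansion F"
    and lt1: "\<And>z. z \<in> ball 0 1 \<Longrightarrow> norm (f z) < 1"
    and gap: "\<And>k. 0 < k \<Longrightarrow> k < n \<Longrightarrow> fps_nth F k = 0" and n: "0 < n"
  shows "norm (fps_nth F n) \<le> 1 - (norm (fps_nth F 0))\<^sup>2"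
proof -
  define c where "c = fps_nth F 0"
  have fc: "f 0 = c"
    using has_fps_expansion_imp_0_eq_fps_nth_0[OF F] by (simp add: c_def)
  have c1: "norm c < 1"
    using lt1[of 0] fc by simp
  have c2: "1 - (norm c)\<^sup>2 > 0"
    using c1 by (simp add: power_less_one_iff)
  have cc: "1 - cnj c * c = of_real (1 - (norm c)\<^sup>2)"
    by (simp add: complex_norm_square mult.commute del: of_real_power)
  have cc0: "1 - cnj c * c \<noteq> 0"
    unfolding cc of_real_eq_0_iff using c2 by linarith
  define M where "M = (\<lambda>z. (f z - c) * inverse (1 - cnj c * f z))"
  have lt: "norm (cnj c * f z) < 1" if "z \<in> ball 0 1" for z
  proof -
    have "norm c * norm (f z) \<le> norm c * 1"
      using lt1[OF that] by (intro mult_left_mono) auto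
    then show ?thesis
      using c1 by (simp add: norm_mult)
  qed
  then have ne: "1 - cnj c * f z \<noteq> 0" if "z \<in> ball 0 1" for z
    using that by (metis eq_iff_diff_eq_0 less_irrefl norm_one)
  have "M holomorphic_on ball 0 1"
    unfolding M_def using hol ne by (auto intro!: holomorphic_intros)
  moreover have M: "M has_fps_expansion (F - fps_const c) * inverse (1 - fps_const (cnj c) * F)"
    unfolding M_def using cc0
    by (intro fps_expansion_intros F) (auto simp: c_def[symmetric])
  moreover have "norm (M z) \<le> 1" if "z \<in> ball 0 1" for z
  proof -
    have "norm (Moebius_function 0 c (f z)) < 1"
      by (rule Moebius_function_norm_lt_1) (use c1 lt1[OF that] in auto)
    then show ?thesis
      by (simp add: M_def Moebius_function_def field_simps)
  qed
  ultimately have "norm (fps_nth ((F - fps_const c) * inverse (1 - fps_const (cnj c) * F)) n) \<le> 1"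
    by (rule norm_fps_nth_le_of_bounded_on_disk)
  \<comment> \<open>Since \<open>F - c\<close> starts at order \<open>n\<close>, only its leading coefficient times the constant coefficient of the
      inverse contributes.\<close>
  also have "fps_nth ((F - fps_const c) * inverse (1 - fps_const (cnj c) * F)) n
     = (\<Sum>i=0..n. if i = n then fps_nth F n * inverse (1 - cnj c * c) else 0)"
    unfolding fps_mult_nth
  proof (rule sum.cong)
    fix i assume "i \<in> {0..n}"
    then consider "i = n" | "i = 0" "i < n" | "0 < i" "i < n" by force
    then show "fps_nth (F - fps_const c) i * fps_nth (inverse (1 - fps_const (cnj c) * F)) (n - i) =
      (if i = n then fps_nth F n * inverse (1 - cnj c * c) else 0)"
      using n gap by cases (auto simp: c_def)
  qed simp
  also have "\<dots> = fps_nth F n * inverse (of_real (1 - (norm c)\<^sup>2))"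
    by (simp add: cc)
  also have "norm \<dots> = norm (fps_nth F n) / (1 - (norm c)\<^sup>2)"
    unfolding norm_mult norm_inverse norm_of_real using c2 by (simp add: divide_simps)
  finally show ?thesis
    using c2 by (simp add: c_def divide_simps)
qed

text \<open>
  The strict inequality keeps \<open>f 0\<close> off the unit circle, where the Moebius map degenerates. A weak bound
  reduces to it by scaling \<open>f\<close> with \<open>s < 1\<close> and letting \<open>s\<close> tend to 1.
\<close>

lemma norm_gap_coeff_le:
  fixes f :: "complex \<Rightarrow> complex"
  assumes hol: "f holomorphic_on ball 0 1" and F: "f has_fps_expansion F"
    and le1: "\<And>z. z \<in> ball 0 1 \<Longrightarrow> norm (f z) \<le> 1"
    and gap: "\<And>k. 0 < k \<Longrightarrow> k < n \<Longrightarrow> fps_nth F k = 0" and n: "0 < n"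
  shows "norm (fps_nth F n) \<le> 1 - (norm (fps_nth F 0))\<^sup>2"
proof -
  have "s * norm (fps_nth F n) \<le> 1 - (s * norm (fps_nth F 0))\<^sup>2" if s: "0 < s" "s < 1" for s :: real
  proof -
    have "norm (fps_nth (fps_const (of_real s) * F) n) \<le> 1 - (norm (fps_nth (fps_const (of_real s) * F) 0))\<^sup>2"
    proof (rule norm_gap_coeff_le_strict)
      show "(\<lambda>z. of_real s * f z) holomorphic_on ball 0 1"
        using hol by (intro holomorphic_intros)
      show "(\<lambda>z. of_real s * f z) has_fps_expansion fps_const (of_real s) * F"
        by (intro fps_expansion_intros F)
      show "norm (of_real s * f z) < 1" if "z \<in> ball 0 1" for z
      proof -
        have "norm (of_real s * f z) = s * norm (f z)"
          using s by (simp add: norm_mult)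
        also have "\<dots> \<le> s * 1"
          using le1[OF that] s by (intro mult_left_mono) auto
        finally show ?thesis
          using s by simp
      qed
    qed (use gap n in auto)
    then show ?thesis
      using s by (simp add: norm_mult)
  qed
  then have "\<forall>\<^sub>F s in at_left (1::real). s * norm (fps_nth F n) \<le> 1 - (s * norm (fps_nth F 0))\<^sup>2"
    using eventually_at_left_real[of 0 "1::real"] by (auto elim!: eventually_mono)
  moreover have "((\<lambda>s::real. s * norm (fps_nth F n)) \<longlongrightarrow> 1 * norm (fps_nth F n)) (at_left 1)"
    by (intro tendsto_intros)
  moreover have "((\<lambda>s::real. 1 - (s * norm (fps_nth F 0))\<^sup>2) \<longlongrightarrow> 1 - (1 * norm (fps_nth F 0))\<^sup>2) (at_left 1)"
    by (intro tendsto_intros)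
  ultimately show ?thesis
    using tendsto_le[of "at_left (1::real)"] by fastforce
qed

text \<open>
  Averaging \<open>f\<close> over the rotations by \<open>n\<close>-th roots of unity keeps the coefficients whose index is a
  multiple of \<open>n\<close>, removes all others, and preserves the bound. This creates the gap that
  \<open>norm_gap_coeff_le\<close> needs.
\<close>

lemma norm_coeff_le_one_minus_square:
  fixes f :: "complex \<Rightarrow> complex"
  assumes hol: "f holomorphic_on ball 0 1" and F: "f has_fps_expansion F"
    and le1: "\<And>z. z \<in> ball 0 1 \<Longrightarrow> norm (f z) \<le> 1"
    and n: "0 < n"
  shows "norm (fps_nth F n) \<le> 1 - (norm (fps_nth F 0))\<^sup>2"
proof -
  define \<omega> :: complex where "\<omega> = exp (2 * of_real pi * \<i> / of_nat n)"
  have norm_\<omega>: "norm (\<omega> ^ k * z) = norm z" for k z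
    by (simp add: \<omega>_def norm_mult norm_power norm_exp_eq_Re)
  have \<omega>_power_eq_1: "\<omega> ^ m = 1 \<longleftrightarrow> n dvd m" for m
    using n complex_root_unity_eq_1[of n m]
    by (simp add: \<omega>_def exp_of_nat_mult[symmetric] mult_ac)
  define g where "g = (\<lambda>z. inverse (of_nat n) * (\<Sum>k<n. f (\<omega> ^ k * z)))"
  define G where "G = fps_const (inverse (of_nat n)) * (\<Sum>k<n. F oo (fps_const (\<omega> ^ k) * fps_X))"
  have G_nth: "fps_nth G m = inverse (of_nat n) * (\<Sum>k<n. (\<omega> ^ m) ^ k) * fps_nth F m" for m
  proof -
    have "(\<omega> ^ k) ^ m = (\<omega> ^ m) ^ k" for k
      by (simp add: power_mult[symmetric] mult.commute)
    then show ?thesis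
      by (simp add: G_def fps_compose_linear fps_sum_nth sum_distrib_right)
  qed
  have \<omega>n: "\<omega> ^ n = 1"
    by (simp add: \<omega>_power_eq_1)
  have "norm (fps_nth G n) \<le> 1 - (norm (fps_nth G 0))\<^sup>2"
  proof (rule norm_gap_coeff_le)
    show "g holomorphic_on ball 0 1"
      unfolding g_def
      by (intro holomorphic_intros holomorphic_on_compose_gen[OF _ hol, unfolded o_def]) (auto simp: norm_\<omega>)
    show "g has_fps_expansion G"
      unfolding g_def G_def
      by (intro fps_expansion_intros has_fps_expansion_compose[OF F, unfolded o_def]) auto
    show "norm (g z) \<le> 1" if "z \<in> ball 0 1" for z
    proof -
      have "norm (\<Sum>k<n. f (\<omega> ^ k * z)) \<le> of_nat (card {..<n}) * 1"
        using that by (intro sum_norm_bound le1) (simp add: norm_\<omega>)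
      then show ?thesis
        using n by (simp add: g_def norm_mult norm_divide norm_inverse divide_simps)
    qed
    show "fps_nth G k = 0" if "0 < k" "k < n" for k
    proof -
      have "(\<Sum>j<n. (\<omega> ^ k) ^ j) = ((\<omega> ^ k) ^ n - 1) / (\<omega> ^ k - 1)"
        using that by (intro geometric_sum) (auto simp: \<omega>_power_eq_1 dest: nat_dvd_not_less)
      also have "(\<omega> ^ k) ^ n = (\<omega> ^ n) ^ k"
        by (simp add: power_mult[symmetric] mult.commute)
      finally show ?thesis
        by (simp add: G_nth \<omega>n)
    qed
  qed (rule n)
  then show ?thesis
    using n by (simp add: G_nth \<omega>n)
qed

section \<open>Functions with positive real part\<close>

text \<open>
  A point of the right half-plane is closer to 1 than to -1, so \<open>(p - 1) / (p + 1)\<close> satisfies the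
  hypotheses of the Schwarz lemma; \<open>h\<close> is its quotient by \<open>z\<close>. The relation is stated without
  division so that it transfers directly to power series.
\<close>

lemma Cayley_Schwarz_representation:
  fixes p :: "complex \<Rightarrow> complex"
  assumes hol: "p holomorphic_on ball 0 1" and p0: "p 0 = 1"
    and pos: "\<And>z. z \<in> ball 0 1 \<Longrightarrow> Re (p z) > 0"
  obtains h where "h holomorphic_on ball 0 1"
    and "\<And>z. z \<in> ball 0 1 \<Longrightarrow> norm (h z) \<le> 1"
    and "\<And>z. z \<in> ball 0 1 \<Longrightarrow> p z * (1 - z * h z) = 1 + z * h z"
proof -
  have ne: "p z + 1 \<noteq> 0" if "z \<in> ball 0 1" for z
    using pos[OF that] by (auto simp: complex_eq_iff)
  define w where "w = (\<lambda>z. (p z - 1) / (p z + 1))"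
  have hol_w: "w holomorphic_on ball 0 1"
    unfolding w_def using hol ne by (intro holomorphic_intros) auto
  have w0: "w 0 = 0"
    by (simp add: w_def p0)
  have w_lt: "norm (w z) < 1" if "norm z < 1" for z
  proof -
    have "(norm (p z - 1))\<^sup>2 < (norm (p z + 1))\<^sup>2"
      using pos[of z] that unfolding cmod_power2 by (simp add: power2_eq_square algebra_simps)
    then have "norm (p z - 1) < norm (p z + 1)"
      by (rule power2_less_imp_less) simp
    then show ?thesis
      using ne[of z] that by (simp add: w_def norm_divide)
  qed
  obtain h where h: "h holomorphic_on ball 0 1" and wh: "\<And>z. norm z < 1 \<Longrightarrow> w z = z * h z"
    and h0: "deriv w 0 = h 0"
    using Schwarz3[OF hol_w w0] by blast
  have "norm (h z) \<le> 1" if "norm z < 1" for z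
  proof (cases "z = 0")
    case True
    then show ?thesis
      using Schwarz_Lemma(2)[OF hol_w w0 w_lt that] h0 by simp
  next
    case False
    then show ?thesis
      using Schwarz_Lemma(1)[OF hol_w w0 w_lt that] wh[OF that] by (simp add: norm_mult)
  qed
  moreover have "p z * (1 - z * h z) = 1 + z * h z" if "norm z < 1" for z
  proof -
    have "z * h z * (p z + 1) = p z - 1"
      using wh[OF that] ne[of z] that by (simp add: w_def field_simps)
    then show ?thesis
      by (simp add: algebra_simps)
  qed
  ultimately show thesis
    using h that by simp
qed

text \<open>
  Here \<open>c1\<close>, \<open>c2\<close>, \<open>c3\<close> are the coefficients of 1, \<open>z\<close>, \<open>z\<^sup>2\<close> in \<open>h\<close>; the equations come from expanding
  \<open>(1 + z h) / (1 - z h)\<close>.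
\<close>

lemma coeffs_of_Re_pos:
  fixes p :: "complex \<Rightarrow> complex"
  assumes hol: "p holomorphic_on ball 0 1" and p0: "p 0 = 1"
    and pos: "\<And>z. z \<in> ball 0 1 \<Longrightarrow> Re (p z) > 0"
    and P: "p has_fps_expansion P"
  obtains c1 c2 c3 where
    "fps_nth P 1 = 2 * c1" "fps_nth P 2 = 2 * (c2 + c1\<^sup>2)"
    "fps_nth P 3 = 2 * (c3 + 2 * c1 * c2 + c1 ^ 3)"
    "norm c1 \<le> 1" "norm c2 \<le> 1 - (norm c1)\<^sup>2" "norm c3 \<le> 1 - (norm c1)\<^sup>2"
proof -
  obtain h where hol_h: "h holomorphic_on ball 0 1"
    and h_le: "\<And>z. z \<in> ball 0 1 \<Longrightarrow> norm (h z) \<le> 1"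
    and eq: "\<And>z. z \<in> ball 0 1 \<Longrightarrow> p z * (1 - z * h z) = 1 + z * h z"
    using Cayley_Schwarz_representation[OF hol p0 pos] by metis
  define H where "H = fps_expansion h 0"
  have H: "h has_fps_expansion H"
    unfolding H_def using hol_h by (intro has_fps_expansion_fps_expansion) auto
  have "\<forall>\<^sub>F z in nhds 0. z \<in> ball (0::complex) 1"
    by (intro eventually_nhds_in_open) auto
  then have ev: "\<forall>\<^sub>F z in nhds 0. p z * (1 - z * h z) = 1 + z * h z"
    by (rule eventually_mono) (rule eq)
  have "(\<lambda>z. p z * (1 - z * h z)) has_fps_expansion P * (1 - fps_X * H)"
    by (intro fps_expansion_intros P H)
  moreover have "(\<lambda>z. 1 + z * h z) has_fps_expansion 1 + fps_X * H"
    by (intro fps_expansion_intros H)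
  ultimately have PH: "P * (1 - fps_X * H) = 1 + fps_X * H"
    using has_fps_expansion_cong[OF ev refl] fps_expansion_unique_complex by blast
  define c1 c2 c3 where "c1 = fps_nth H 0" and "c2 = fps_nth H 1" and "c3 = fps_nth H 2"
  have P0: "fps_nth P 0 = 1"
    using has_fps_expansion_imp_0_eq_fps_nth_0[OF P] p0 by simp
  have Pn: "fps_nth P (Suc n) - (\<Sum>i=0..n. fps_nth P i * fps_nth H (n - i)) = fps_nth H n" for n
  proof -
    have "P - fps_X * (P * H) = 1 + fps_X * H"
      using PH by (simp add: algebra_simps)
    from arg_cong[OF this, of "\<lambda>A. fps_nth A (Suc n)"] show ?thesis
      by (simp add: fps_mult_nth[of P H])
  qed
  have P1: "fps_nth P 1 = 2 * c1"
    using Pn[of 0] P0 by (simp add: c1_def algebra_simps)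
  have P2: "fps_nth P 2 = 2 * (c2 + c1\<^sup>2)"
    using Pn[of 1] P0 P1
    by (simp add: c1_def c2_def numeral_2_eq_2 algebra_simps)
  have P3: "fps_nth P 3 = 2 * (c3 + 2 * c1 * c2 + c1 ^ 3)"
    using Pn[of 2] P0 P1 P2
    by (simp add: c1_def c2_def c3_def eval_nat_numeral algebra_simps)
  have "norm c1 \<le> 1"
    using h_le[of 0] has_fps_expansion_imp_0_eq_fps_nth_0[OF H] by (simp add: c1_def)
  moreover have "norm c2 \<le> 1 - (norm c1)\<^sup>2" "norm c3 \<le> 1 - (norm c1)\<^sup>2"
    unfolding c1_def c2_def c3_def
    by (intro norm_coeff_le_one_minus_square[OF hol_h H h_le]; simp)+
  ultimately show thesis
    using that P1 P2 P3 by blast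
qed

section \<open>The inverse function\<close>

text \<open>
  The Noshiro-Warschawski criterion. If \<open>f a = f b\<close>, the mean value theorem for the real part of
  \<open>f / (b - a)\<close> along the segment from \<open>a\<close> to \<open>b\<close> gives a point where \<open>Re f'\<close> vanishes.
\<close>

lemma inj_on_of_Re_deriv_pos:
  fixes f :: "complex \<Rightarrow> complex"
  assumes hol: "f holomorphic_on S" and S: "open S" "convex S"
    and pos: "\<And>z. z \<in> S \<Longrightarrow> Re (deriv f z) > 0"
  shows "inj_on f S"
proof (rule inj_onI, rule ccontr)
  fix a b assume ab: "a \<in> S" "b \<in> S" "f a = f b" "a \<noteq> b"
  have sub: "closed_segment a b \<subseteq> S"
    using ab S by (simp add: closed_segment_subset)
  have "\<exists>u. u \<in> closed_segment a b \<and>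
      Re (f b / (b - a)) - Re (f a / (b - a)) = Re (deriv f u / (b - a) * (b - a))"
  proof (rule complex_mvt_line)
    fix u assume "u \<in> closed_segment a b"
    then have "(f has_field_derivative deriv f u) (at u)"
      using hol S sub by (meson holomorphic_derivI subsetD)
    then show "((\<lambda>z. f z / (b - a)) has_field_derivative deriv f u / (b - a)) (at u)"
      by (rule DERIV_cdivide)
  qed
  then obtain u where "u \<in> closed_segment a b" "Re (deriv f u) = 0"
    using ab by auto
  then show False
    using pos sub by force
qed

text \<open>
  Injectivity makes \<open>the_inv_into\<close> a genuine holomorphic inverse near 0, so its power series \<open>G\<close> satisfies
  \<open>G oo F = fps_X\<close>. This determines the coefficients of \<open>G\<close> one after the other.
\<close>

lemma inv_coeffs_class_R:
  assumes f: "f \<in> class_R"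
  defines "a \<equiv> fps_nth (fps_expansion f 0)"
  shows "inv_coeff f 0 = 0" "inv_coeff f 1 = 1" "inv_coeff f 2 = - a 2"
    "inv_coeff f 3 = 2 * (a 2)\<^sup>2 - a 3"
    "inv_coeff f 4 = 5 * a 2 * a 3 - 5 * (a 2) ^ 3 - a 4"
proof -
  define g where "g = the_inv_into (ball 0 1) f"
  define F G where "F = fps_expansion f 0" and "G = fps_expansion g 0"
  have hol: "f holomorphic_on ball 0 1" and f0: "f 0 = 0" and f1: "deriv f 0 = 1"
    and pos: "\<And>z. z \<in> ball 0 1 \<Longrightarrow> Re (deriv f z) > 0"
    using f by (auto simp: class_R_def class_A_def)
  have inj: "inj_on f (ball 0 1)"
    by (rule inj_on_of_Re_deriv_pos[OF hol _ _ pos]) auto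
  have gf: "g (f z) = z" if "z \<in> ball 0 1" for z
    unfolding g_def using inj that by (rule the_inv_into_f_f)
  obtain g' where g': "g' holomorphic_on f ` ball 0 1" "\<And>z. z \<in> ball 0 1 \<Longrightarrow> g' (f z) = z"
    using holomorphic_has_inverse[OF hol open_ball inj] by metis
  have "g holomorphic_on f ` ball 0 1"
    using g' gf by (subst holomorphic_cong[OF refl, of _ g g']) auto
  moreover have "open (f ` ball 0 1)"
    using hol open_ball inj by (rule open_mapping_thm3)
  moreover have "0 \<in> f ` ball 0 1"
    using f0 imageI[of 0 "ball 0 1" f] by simp
  ultimately have G: "g has_fps_expansion G"
    unfolding G_def by (intro has_fps_expansion_fps_expansion)
  have F: "f has_fps_expansion F"
    unfolding F_def using hol by (intro has_fps_expansion_fps_expansion) auto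
  have F0: "fps_nth F 0 = 0"
    using fps_nth_fps_expansion[OF F, of 0] f0 by simp
  have F1: "fps_nth F 1 = 1"
    using fps_nth_fps_expansion[OF F, of 1] f1 by simp
  have "\<forall>\<^sub>F z in nhds 0. z \<in> ball (0::complex) 1"
    by (intro eventually_nhds_in_open) auto
  then have "\<forall>\<^sub>F z in nhds 0. (g \<circ> f) z = z"
    by (rule eventually_mono) (simp add: gf)
  moreover have "(g \<circ> f) has_fps_expansion (G oo F)"
    using G F F0 by (rule has_fps_expansion_compose)
  ultimately have GF: "G oo F = fps_X"
    using has_fps_expansion_cong[of "g \<circ> f" "\<lambda>z. z" "G oo F" "G oo F"]
      has_fps_expansion_fps_X fps_expansion_unique_complex by blast
  have coeff: "(\<Sum>i=0..n. fps_nth G i * fps_nth (F ^ i) n) = (if n = 1 then 1 else 0)" for n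
    using arg_cong[OF GF, of "\<lambda>A. fps_nth A n"] by (simp add: fps_compose_nth)
  have G_eq: "inv_coeff f n = fps_nth G n" for n
    by (simp add: inv_coeff_def G_def g_def)
  have a_eq: "a n = fps_nth F n" for n
    by (simp add: a_def F_def)
  note expand = F0 F1[unfolded One_nat_def] fps_mult_nth eval_nat_numeral algebra_simps
  have G0: "fps_nth G 0 = 0"
    using coeff[of 0] by simp
  have G1: "fps_nth G 1 = 1"
    using coeff[of 1] F1 by simp
  have G2: "fps_nth G 2 = - fps_nth F 2"
    using coeff[of 2] G0 G1 by (simp add: expand add_eq_0_iff)
  have G3: "fps_nth G 3 = 2 * (fps_nth F 2)\<^sup>2 - fps_nth F 3"
    using coeff[of 3] G0 G1 G2 by (simp add: expand add_eq_0_iff)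
  have G4: "fps_nth G 4 = 5 * fps_nth F 2 * fps_nth F 3 - 5 * (fps_nth F 2) ^ 3 - fps_nth F 4"
  proof -
    have "fps_nth F 4 + fps_nth G 2 * (2 * fps_nth F 3 + (fps_nth F 2)\<^sup>2)
        + 3 * fps_nth G 3 * fps_nth F 2 + fps_nth G 4 = 0"
      using coeff[of 4] G0 G1 by (simp add: expand)
    moreover have "fps_nth F 4 + fps_nth G 2 * (2 * fps_nth F 3 + (fps_nth F 2)\<^sup>2)
        + 3 * fps_nth G 3 * fps_nth F 2 + fps_nth G 4
        = fps_nth G 4 - (5 * fps_nth F 2 * fps_nth F 3 - 5 * (fps_nth F 2) ^ 3 - fps_nth F 4)"
      unfolding G2 G3 by (simp add: algebra_simps power2_eq_square power3_eq_cube)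
    ultimately show ?thesis
      by simp
  qed
  show "inv_coeff f 0 = 0" "inv_coeff f 1 = 1" "inv_coeff f 2 = - a 2"
    "inv_coeff f 3 = 2 * (a 2)\<^sup>2 - a 3"
    "inv_coeff f 4 = 5 * a 2 * a 3 - 5 * (a 2) ^ 3 - a 4"
    unfolding G_eq a_eq by (rule G0 G1 G2 G3 G4)+
qed

section \<open>The Toeplitz determinants\<close>

text \<open>
  In the estimates of \<open>A4\<close> and of the second factor of the third determinant, the difference between the claimed
  bound and the majorant factors as \<open>1 - t\<close>, respectively \<open>1 - t\<^sup>2\<close>, times something positive on
  \<open>[0, 1]\<close>, where \<open>t = \<bar>c1\<bar>\<close>.
\<close>

lemma inverse_Toeplitz_bounds:
  fixes A2 A3 A4 c1 c2 c3 :: complex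
  assumes A2: "A2 = - c1"
    and A3: "A3 = (4 * c1\<^sup>2 - 2 * c2) / 3"
    and A4: "A4 = - c3 / 2 + 7 / 3 * c1 * c2 - 13 / 6 * c1 ^ 3"
    and c1: "norm c1 \<le> 1" and c2: "norm c2 \<le> 1 - (norm c1)\<^sup>2" and c3: "norm c3 \<le> 1 - (norm c1)\<^sup>2"
  shows "norm (A2\<^sup>2 - A3\<^sup>2) \<le> 25 / 9" "norm (A3\<^sup>2 - A4\<^sup>2) \<le> 233 / 36"
    "norm ((A2 - A4) * (A2\<^sup>2 - 2 * A3\<^sup>2 + A2 * A4)) \<le> 817 / 108"
proof -
  define t where "t = norm c1"
  have t: "0 \<le> t" "t \<le> 1" and c2t: "norm c2 \<le> 1 - t\<^sup>2" and c3t: "norm c3 \<le> 1 - t\<^sup>2"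
    using c1 c2 c3 by (auto simp: t_def)
  have t2: "0 \<le> t\<^sup>2" "t\<^sup>2 \<le> 1"
    using t by (auto simp: power_le_one)
  have A2_le: "norm A2 \<le> 1"
    using c1 by (simp add: A2)
  have "norm (4 * c1\<^sup>2 - 2 * c2) \<le> 4 * t\<^sup>2 + 2 * norm c2"
    by (rule norm_triangle_le_diff) (simp add: norm_mult norm_power t_def)
  also have "\<dots> \<le> 4"
    using c2t t2 by linarith
  finally have A3_le: "norm A3 \<le> 4 / 3"
    by (simp add: A3 norm_divide)
  have "norm A4 \<le> norm c3 / 2 + 7 / 3 * t * norm c2 + 13 / 6 * t ^ 3"
    unfolding A4
    by (intro order_trans[OF norm_triangle_ineq4] add_mono order_trans[OF norm_triangle_ineq])
      (auto simp: norm_mult norm_divide norm_power t_def)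
  also have "\<dots> \<le> (1 - t\<^sup>2) / 2 + 7 / 3 * t * (1 - t\<^sup>2) + 13 / 6 * t ^ 3"
    using c2t c3t t by (intro add_mono mult_left_mono) auto
  also have "\<dots> \<le> 13 / 6"
  proof -
    have "13 / 6 - ((1 - t\<^sup>2) / 2 + 7 / 3 * t * (1 - t\<^sup>2) + 13 / 6 * t ^ 3) = (1 - t) * (10 - 4 * t - t\<^sup>2) / 6"
      by (simp add: field_simps power2_eq_square power3_eq_cube)
    moreover have "0 \<le> (1 - t) * (10 - 4 * t - t\<^sup>2)"
      using t t2 by (intro mult_nonneg_nonneg) auto
    ultimately show ?thesis
      by linarith
  qed
  finally have A4_le: "norm A4 \<le> 13 / 6" .
  have sq: "norm (x\<^sup>2) \<le> b\<^sup>2" if "norm x \<le> b" for x :: complex and b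
    using that by (simp add: norm_power power_mono)
  show "norm (A2\<^sup>2 - A3\<^sup>2) \<le> 25 / 9"
    using norm_triangle_ineq4[of "A2\<^sup>2" "A3\<^sup>2"] sq[OF A2_le] sq[OF A3_le]
    by (simp add: power2_eq_square)
  show "norm (A3\<^sup>2 - A4\<^sup>2) \<le> 233 / 36"
    using norm_triangle_ineq4[of "A3\<^sup>2" "A4\<^sup>2"] sq[OF A3_le] sq[OF A4_le]
    by (simp add: power2_eq_square)
  \<comment> \<open>The terms of degree four combine as \<open>13/6 - 32/9 = -25/18\<close>, so this factor must be expanded before the
      triangle inequality is applied; bounding its three terms separately would lose too much.\<close>
  have Q: "A2\<^sup>2 - 2 * A3\<^sup>2 + A2 * A4
      = c1\<^sup>2 - 25 / 18 * c1 ^ 4 + 11 / 9 * c1\<^sup>2 * c2 - 8 / 9 * c2\<^sup>2 + c1 * c3 / 2"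
    unfolding A2 A3 A4 by (simp add: field_simps power2_eq_square power3_eq_cube power4_eq_xxxx)
  have "norm (A2\<^sup>2 - 2 * A3\<^sup>2 + A2 * A4)
      \<le> t\<^sup>2 + 25 / 18 * t ^ 4 + 11 / 9 * t\<^sup>2 * norm c2 + 8 / 9 * (norm c2)\<^sup>2 + t * norm c3 / 2"
    unfolding Q
    by (intro order_trans[OF norm_triangle_ineq4] add_mono order_trans[OF norm_triangle_ineq])
      (auto simp: norm_mult norm_divide norm_power t_def)
  \<comment> \<open>Bounding the factor \<open>t\<close> of \<open>norm c3\<close> by 1 costs nothing at \<open>t = 1\<close> and leaves a polynomial in \<open>t\<^sup>2\<close>.\<close>
  also have "\<dots> \<le> t\<^sup>2 + 25 / 18 * t ^ 4 + 11 / 9 * t\<^sup>2 * (1 - t\<^sup>2) + 8 / 9 * (1 - t\<^sup>2)\<^sup>2 + 1 * (1 - t\<^sup>2) / 2"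
    using c2t c3t t t2 by (intro add_mono mult_left_mono power_mono divide_right_mono mult_mono) auto
  also have "\<dots> \<le> 43 / 18"
  proof -
    have "43 / 18 - (t\<^sup>2 + 25 / 18 * t ^ 4 + 11 / 9 * t\<^sup>2 * (1 - t\<^sup>2) + 8 / 9 * (1 - t\<^sup>2)\<^sup>2 + 1 * (1 - t\<^sup>2) / 2)
        = (1 - t\<^sup>2) * (18 + 19 * t\<^sup>2) / 18"
      by (simp add: field_simps power2_eq_square power4_eq_xxxx)
    moreover have "0 \<le> (1 - t\<^sup>2) * (18 + 19 * t\<^sup>2)"
      using t2 by (intro mult_nonneg_nonneg) auto
    ultimately show ?thesis
      by linarith
  qed
  finally have "norm (A2\<^sup>2 - 2 * A3\<^sup>2 + A2 * A4) \<le> 43 / 18" .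
  moreover have "norm (A2 - A4) \<le> 19 / 6"
    using norm_triangle_ineq4[of A2 A4] A2_le A4_le by linarith
  ultimately have "norm (A2 - A4) * norm (A2\<^sup>2 - 2 * A3\<^sup>2 + A2 * A4) \<le> 19 / 6 * (43 / 18)"
    by (intro mult_mono) auto
  then show "norm ((A2 - A4) * (A2\<^sup>2 - 2 * A3\<^sup>2 + A2 * A4)) \<le> 817 / 108"
    by (simp add: norm_mult)
qed

lemma T_inv_eqs:
  "T_inv 2 2 f = (inv_coeff f 2)\<^sup>2 - (inv_coeff f 3)\<^sup>2"
  "T_inv 2 3 f = (inv_coeff f 3)\<^sup>2 - (inv_coeff f 4)\<^sup>2"
  "T_inv 3 2 f = (inv_coeff f 2 - inv_coeff f 4) *
    ((inv_coeff f 2)\<^sup>2 - 2 * (inv_coeff f 3)\<^sup>2 + inv_coeff f 2 * inv_coeff f 4)"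
  by (simp_all add: sym_toeplitz_det_2 sym_toeplitz_det_3)

lemma fps_expansion_deriv_disk:
  assumes hol: "f holomorphic_on ball 0 1"
  shows "deriv f has_fps_expansion fps_deriv (fps_expansion f 0)"
  using hol by (intro fps_expansion_intros has_fps_expansion_fps_expansion[of "ball 0 1"]) auto

lemma T_inv_bounds:
  assumes f: "f \<in> class_R"
  shows "norm (T_inv 2 2 f) \<le> 25 / 9" "norm (T_inv 2 3 f) \<le> 233 / 36"
    "norm (T_inv 3 2 f) \<le> 817 / 108"
proof -
  have hol: "f holomorphic_on ball 0 1" and f1: "deriv f 0 = 1"
    and pos: "\<And>z. z \<in> ball 0 1 \<Longrightarrow> Re (deriv f z) > 0"
    using f by (auto simp: class_R_def class_A_def)
  define a where "a = fps_nth (fps_expansion f 0)"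
  obtain c1 c2 c3 where
    "fps_nth (fps_deriv (fps_expansion f 0)) 1 = 2 * c1"
    "fps_nth (fps_deriv (fps_expansion f 0)) 2 = 2 * (c2 + c1\<^sup>2)"
    "fps_nth (fps_deriv (fps_expansion f 0)) 3 = 2 * (c3 + 2 * c1 * c2 + c1 ^ 3)"
    and c: "norm c1 \<le> 1" "norm c2 \<le> 1 - (norm c1)\<^sup>2" "norm c3 \<le> 1 - (norm c1)\<^sup>2"
    using coeffs_of_Re_pos[OF holomorphic_deriv[OF hol open_ball] f1 pos fps_expansion_deriv_disk[OF hol]]
    by blast
  then have a: "a 2 = 2 * c1 / 2" "a 3 = 2 * (c2 + c1\<^sup>2) / 3"
    "a 4 = 2 * (c3 + 2 * c1 * c2 + c1 ^ 3) / 4"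
    by (simp_all add: a_def eval_nat_numeral eq_divide_eq mult.commute del: distrib_left_numeral distrib_right_numeral)
  note A = inv_coeffs_class_R(3-5)[OF f, folded a_def, unfolded a]
  have A2: "inv_coeff f 2 = - c1"
    by (simp add: A)
  have A3: "inv_coeff f 3 = (4 * c1\<^sup>2 - 2 * c2) / 3"
    by (simp add: A field_simps)
  have A4: "inv_coeff f 4 = - c3 / 2 + 7 / 3 * c1 * c2 - 13 / 6 * c1 ^ 3"
    by (simp add: A field_simps power2_eq_square power3_eq_cube)
  show "norm (T_inv 2 2 f) \<le> 25 / 9" "norm (T_inv 2 3 f) \<le> 233 / 36"
    "norm (T_inv 3 2 f) \<le> 817 / 108"
    unfolding T_inv_eqs by (intro inverse_Toeplitz_bounds[OF A2 A3 A4 c])+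
qed

section \<open>The extremal function\<close>

lemma one_minus_i_mult_ne_0:
  assumes "norm z < 1" shows "1 - \<i> * z \<noteq> 0"
  using assms by (metis eq_iff_diff_eq_0 less_irrefl norm_ii norm_mult mult_1 norm_one)

lemma extremal_function_exists:
  "\<exists>f. f holomorphic_on ball 0 1 \<and> f 0 = 0 \<and>
    (\<forall>z\<in>ball 0 1. deriv f z = (1 + \<i> * z) / (1 - \<i> * z))"
proof -
  have "(\<lambda>z. (1 + \<i> * z) / (1 - \<i> * z)) holomorphic_on ball 0 1"
    by (intro holomorphic_intros) (auto dest: one_minus_i_mult_ne_0)
  from holomorphic_convex_primitive'[OF convex_ball open_ball this] obtain F where
    F: "\<And>z. z \<in> ball 0 1 \<Longrightarrow>
      (F has_field_derivative (1 + \<i> * z) / (1 - \<i> * z)) (at z within ball 0 1)"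
    by blast
  have d: "((\<lambda>z. F z - F 0) has_field_derivative (1 + \<i> * z) / (1 - \<i> * z)) (at z)"
    if "z \<in> ball 0 1" for z
    using F[OF that] that by (auto intro!: derivative_eq_intros simp: at_within_open[OF _ open_ball])
  show ?thesis
  proof (intro exI[of _ "\<lambda>z. F z - F 0"] conjI ballI)
    show "(\<lambda>z. F z - F 0) holomorphic_on ball 0 1"
      unfolding holomorphic_on_open[OF open_ball] using d by blast
    show "deriv (\<lambda>z. F z - F 0) z = (1 + \<i> * z) / (1 - \<i> * z)" if "z \<in> ball 0 1" for z
      using d[OF that] by (rule DERIV_imp_deriv)
  qed simp
qed

lemma Re_half_plane_map_pos:
  assumes "norm z < 1"
  shows "Re ((1 + \<i> * z) / (1 - \<i> * z)) > 0"
proof -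
  have "1 - Re z ^ 2 - Im z ^ 2 > 0"
    using assms by (simp add: cmod_def real_sqrt_lt_1_iff power_less_one_iff)
  moreover have "(1 + Im z)\<^sup>2 + (Re z)\<^sup>2 > 0"
    using one_minus_i_mult_ne_0[OF assms] by (auto simp: complex_eq_iff sum_power2_gt_zero_iff)
  moreover have "Re ((1 + \<i> * z) / (1 - \<i> * z)) =
     (1 - Re z ^ 2 - Im z ^ 2) / ((1 + Im z)\<^sup>2 + (Re z)\<^sup>2)"
    by (simp add: Re_divide power2_eq_square algebra_simps)
  ultimately show ?thesis by simp
qed

text \<open>
  Clearing the denominator in \<open>f' = (1 + \<i>z) / (1 - \<i>z)\<close> turns it into a first-order recursion for the
  coefficients of \<open>f'\<close>; those of \<open>f\<close> and of its inverse follow from them.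
\<close>

lemma extremal_function_properties:
  assumes hol: "f holomorphic_on ball 0 1" and f0: "f 0 = 0"
    and df: "\<And>z. z \<in> ball 0 1 \<Longrightarrow> deriv f z = (1 + \<i> * z) / (1 - \<i> * z)"
  shows "f \<in> class_R"
    and "map (fps_nth (fps_expansion (deriv f) 0)) [0..<5] = [1, 2 * \<i>, -2, -2 * \<i>, 2]"
    and "map (fps_nth (fps_expansion f 0)) [0..<5] = [0, 1, \<i>, -2 / 3, -\<i> / 2]"
    and "map (inv_coeff f) [0..<5] = [0, 1, -\<i>, -4 / 3, 13 / 6 * \<i>]"
proof -
  show f: "f \<in> class_R"
    using hol f0 df Re_half_plane_map_pos by (simp add: class_R_def class_A_def)
  define F where "F = fps_expansion f 0"
  define P where "P = fps_deriv F"
  have dP: "deriv f has_fps_expansion P"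
    unfolding P_def F_def using hol by (rule fps_expansion_deriv_disk)
  have "\<forall>\<^sub>F z in nhds 0. z \<in> ball (0::complex) 1"
    by (intro eventually_nhds_in_open) auto
  then have ev: "\<forall>\<^sub>F z in nhds 0. deriv f z * (1 - \<i> * z) = 1 + \<i> * z"
    by (rule eventually_mono) (use df one_minus_i_mult_ne_0 in auto)
  have "(\<lambda>z. deriv f z * (1 - \<i> * z)) has_fps_expansion P * (1 - fps_const \<i> * fps_X)"
    by (intro fps_expansion_intros dP)
  moreover have "(\<lambda>z. 1 + \<i> * z) has_fps_expansion 1 + fps_const \<i> * fps_X"
    by (intro fps_expansion_intros)
  ultimately have "P * (1 - fps_const \<i> * fps_X) = 1 + fps_const \<i> * fps_X"
    using has_fps_expansion_cong[OF ev refl] fps_expansion_unique_complex by blast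
  then have P_eq: "P = 1 + fps_const \<i> * fps_X + fps_const \<i> * (fps_X * P)"
    by (simp add: algebra_simps)
  have P0: "fps_nth P 0 = 1"
    by (subst P_eq) simp
  have PS: "fps_nth P (Suc n) = \<i> * ((if n = 0 then 1 else 0) + fps_nth P n)" for n
    by (subst P_eq) (simp add: algebra_simps)
  have P: "fps_nth P 0 = 1" "fps_nth P 1 = 2 * \<i>" "fps_nth P 2 = -2" "fps_nth P 3 = -2 * \<i>"
    "fps_nth P 4 = 2"
    by (simp_all add: eval_nat_numeral P0 PS)
  have upt: "[0..<5] = [0, 1, 2, 3, 4::nat]"
    by (simp add: upt_rec)
  show "map (fps_nth (fps_expansion (deriv f) 0)) [0..<5] = [1, 2 * \<i>, -2, -2 * \<i>, 2]"
    unfolding upt fps_expansion_eqI[OF dP] using P by simp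
  have F0: "fps_nth F 0 = 0"
    using f0 by (simp add: F_def fps_expansion_def)
  have F: "fps_nth F 1 = 1" "fps_nth F 2 = \<i>" "fps_nth F 3 = -2 / 3" "fps_nth F 4 = - \<i> / 2"
    using P(1-4) by (simp_all add: P_def eval_nat_numeral field_simps)
  show "map (fps_nth (fps_expansion f 0)) [0..<5] = [0, 1, \<i>, -2 / 3, -\<i> / 2]"
    unfolding upt F_def[symmetric] using F0 F by simp
  show "map (inv_coeff f) [0..<5] = [0, 1, -\<i>, -4 / 3, 13 / 6 * \<i>]"
    unfolding upt list.map inv_coeffs_class_R[OF f, folded F_def] F
    by (simp add: power2_eq_square power3_eq_cube)
qed

theorem theorem3:
  shows "(\<forall>f\<in>class_R.
            cmod (T_inv 2 2 f) \<le> 25 / 9 \<and>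
            cmod (T_inv 2 3 f) \<le> 233 / 36 \<and>
            cmod (T_inv 3 2 f) \<le> 817 / 108) \<and>
         (\<exists>f. f holomorphic_on ball 0 1 \<and> f 0 = 0 \<and>
            (\<forall>z\<in>ball 0 1. deriv f z = (1 + \<i> * z) / (1 - \<i> * z))) \<and>
         (\<forall>f. f holomorphic_on ball 0 1 \<and> f 0 = 0 \<and>
            (\<forall>z\<in>ball 0 1. deriv f z = (1 + \<i> * z) / (1 - \<i> * z)) \<longrightarrow>
            f \<in> class_R \<and>
            map (fps_nth (fps_expansion (deriv f) 0)) [0..<5] = [1, 2 * \<i>, -2, -2 * \<i>, 2] \<and>
            map (fps_nth (fps_expansion f 0)) [0..<5] = [0, 1, \<i>, -2 / 3, -\<i> / 2] \<and>
            map (inv_coeff f) [0..<5] = [0, 1, -\<i>, -4 / 3, 13 / 6 * \<i>] \<and>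
            cmod (T_inv 2 2 f) = 25 / 9 \<and>
            cmod (T_inv 2 3 f) = 233 / 36 \<and>
            cmod (T_inv 3 2 f) = 817 / 108)"
proof (intro conjI ballI allI impI)
  fix f assume "f \<in> class_R"
  then show "cmod (T_inv 2 2 f) \<le> 25 / 9" "cmod (T_inv 2 3 f) \<le> 233 / 36"
    "cmod (T_inv 3 2 f) \<le> 817 / 108"
    by (rule T_inv_bounds)+
next
  show "\<exists>f. f holomorphic_on ball 0 1 \<and> f 0 = 0 \<and>
    (\<forall>z\<in>ball 0 1. deriv f z = (1 + \<i> * z) / (1 - \<i> * z))"
    by (rule extremal_function_exists)
next
  fix f :: "complex \<Rightarrow> complex"
  assume "f holomorphic_on ball 0 1 \<and> f 0 = 0 \<and>
    (\<forall>z\<in>ball 0 1. deriv f z = (1 + \<i> * z) / (1 - \<i> * z))"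
  then have hol: "f holomorphic_on ball 0 1" and f0: "f 0 = 0"
    and df: "\<And>z. z \<in> ball 0 1 \<Longrightarrow> deriv f z = (1 + \<i> * z) / (1 - \<i> * z)"
    by auto
  note props = extremal_function_properties[OF hol f0 df]
  show "f \<in> class_R"
    by (rule props(1))
  show "map (fps_nth (fps_expansion (deriv f) 0)) [0..<5] = [1, 2 * \<i>, -2, -2 * \<i>, 2]"
    by (rule props(2))
  show "map (fps_nth (fps_expansion f 0)) [0..<5] = [0, 1, \<i>, -2 / 3, -\<i> / 2]"
    by (rule props(3))
  show "map (inv_coeff f) [0..<5] = [0, 1, -\<i>, -4 / 3, 13 / 6 * \<i>]"
    by (rule props(4))
  have A: "inv_coeff f 2 = - \<i>" "inv_coeff f 3 = - 4 / 3" "inv_coeff f 4 = 13 / 6 * \<i>"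
    using props(4) by (simp_all add: upt_rec eval_nat_numeral)
  have T: "T_inv 2 2 f = - 25 / 9" "T_inv 2 3 f = 233 / 36" "T_inv 3 2 f = 817 / 108 * \<i>"
    unfolding T_inv_eqs A by (simp_all add: power2_eq_square field_simps)
  show "cmod (T_inv 2 2 f) = 25 / 9" "cmod (T_inv 2 3 f) = 233 / 36" "cmod (T_inv 3 2 f) = 817 / 108"
    unfolding T by (simp_all add: norm_mult)
qed

end
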